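(* Let $\mathcal{H}$ be a real Hilbert space, let $A, C\colon \mathcal{H}\rightrightarrows\mathcal{H}$ be maximally monotone operators, and let $B\colon\mathcal{H}\to\mathcal{H}$ be single-valued, monotone and $L$-Lipschitz continuous with $L>0$. Suppose $(A+B+C)^{-1}(0)\neq\emptyset$ and let $\lambda\in\left(0,\frac{1}{22L}\right)$. For arbitrary initial points $z_0, y_{-1}, y_{-2}\in\mathcal{H}$, consider the sequences $(z_k)_{k\in\mathbb{N}}$, $(x_k)_{k\in\mathbb{N}}$ and $(y_k)_{k\in\mathbb{N}}$ given, for $k=0,1,2,\dots$, by $$ \left\{\begin{aligned} x_k &= J_{\lambda A}(z_k),\\ y_k &= J_{\lambda C}\bigl(2x_k - z_k - \lambda B(2y_{k-1} - y_{k-2})\bigr),\\ z_{k+1} &= z_k + y_k - x_k. \end{aligned}\right. $$ Then the following assertions hold: (a) The sequence $(z_k)_{k\in\mathbb{N}}$ converges weakly to a point $\bar z\in\mathcal{H}$. (b) The sequences $(x_k)_{k\in\mathbb{N}}$ and $(y_k)_{k\in\mathbb{N}}$ converge weakly to a (common) point $\bar x\in\mathcal{H}$. (c) We have $\bar x = J_{\lambda A}(\bar z)\in (A+B+C)^{-1}(0)$.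
   Context: $\mathbb{N}=\{0,1,2,\dots\}$. For a maximally monotone operator $T\colon\mathcal{H}\rightrightarrows\mathcal{H}$, $J_T := (\mathrm{Id}+T)^{-1}$ denotes its resolvent, which is a single-valued operator defined on all of $\mathcal{H}$. The set $(A+B+C)^{-1}(0)$ is $\{x\in\mathcal{H} : 0\in A(x)+B(x)+C(x)\}$. The iteration in the claim is called the backward-reflected-forward-backward method. *)

theory Defs
  imports "HOL-Analysis.Analysis"
begin

text \<open>
  A set-valued operator on a space \<open>'a\<close> is a function of type \<open>'a \<Rightarrow> 'a set\<close>; a single-valued
  map \<open>B\<close> is identified with \<open>\<lambda>x. {B x}\<close>. Sums of operator values are elementwise (Minkowski)
  sums of sets, as in \<^theory>\<open>HOL-Library.Set_Algebras\<close>.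
\<close>

definition monotone_operator :: "('a::real_inner \<Rightarrow> 'a set) \<Rightarrow> bool" where
  "monotone_operator T \<longleftrightarrow>
     (\<forall>x y. \<forall>u\<in>T x. \<forall>v\<in>T y. 0 \<le> (x - y) \<bullet> (u - v))"

text \<open>Maximality is with respect to inclusion of graphs.\<close>

definition maximally_monotone :: "('a::real_inner \<Rightarrow> 'a set) \<Rightarrow> bool" where
  "maximally_monotone T \<longleftrightarrow> monotone_operator T \<and>
     (\<forall>S. monotone_operator S \<and> (\<forall>x. T x \<subseteq> S x) \<longrightarrow> S = T)"

definition operator_inverse :: "('a \<Rightarrow> 'a set) \<Rightarrow> 'a \<Rightarrow> 'a set" where
  "operator_inverse T y = {x. y \<in> T x}"

definition scale_operator :: "real \<Rightarrow> ('a::real_vector \<Rightarrow> 'a set) \<Rightarrow> 'a \<Rightarrow> 'a set" where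
  "scale_operator c T x = (\<lambda>u. c *\<^sub>R u) ` T x"

text \<open>
  The single-valued map underlying \<open>(Id + T)\<inverse>\<close>. The description is meaningful when
  \<open>T\<close> is maximally monotone on a Hilbert space, since then \<open>(Id + T)\<inverse> z\<close> is a singleton
  for every \<open>z\<close> (Minty's theorem).
\<close>

definition resolvent :: "('a::real_vector \<Rightarrow> 'a set) \<Rightarrow> 'a \<Rightarrow> 'a" where
  "resolvent T z = (THE x. x \<in> operator_inverse (\<lambda>x. {x} + T x) z)"

definition weakly_converges :: "(nat \<Rightarrow> 'a::real_inner) \<Rightarrow> 'a \<Rightarrow> bool" where
  "weakly_converges X l \<longleftrightarrow> (\<forall>u. (\<lambda>n. X n \<bullet> u) \<longlonglongrightarrow> l \<bullet> u)"

end

theory Submission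
  imports Defs "HOL-Library.Diagonal_Subsequence"
begin

text \<open>
  Absorb the step size into the operators, so that \<open>B\<close> is \<open>\<tau>\<close>-Lipschitz with \<open>\<tau> \<le> 1/22\<close>. For a zero \<open>x*\<close> of
  the sum and \<open>z* \<in> x* + A x*\<close> with \<open>x* - z* - B x* \<in> C x*\<close>, put \<open>w_k = 2 y_(k-1) - y_(k-2)\<close>. Monotonicity of the
  three operators bounds the decrease of \<open>|z_k - z*|^2\<close> up to the term \<open>-2 (y_k - w_k) \<bullet> (B w_k - B x*)\<close>;
  since \<open>y_k - w_k\<close> is a difference of successive increments of \<open>y\<close>, this telescopes up to products of
  such increments. Nonexpansiveness of \<open>J_C\<close> and of the reflected resolvent \<open>2 J_A - Id\<close> gives
  \<open>|y_(k+1) - y_k| \<le> |z_(k+1) - z_k| + \<tau> |w_(k+1) - w_k|\<close>, so these products are absorbed by the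
  decrease, and \<open>|z_k - z*|\<close> converges. Opial's argument then yields weak convergence. Minty's theorem
  and the Riesz representation on closed subspaces (used for weak compactness) both come from
  minimising a convex function plus half the squared norm.
\<close>

section \<open>Convex minimisation and Minty's theorem\<close>

text \<open>\<open>E\<close> plays the role of the epigraph of a convex function. Adding half the
  squared norm makes minimising sequences Cauchy in \<open>p\<close>. The last conclusion is the
  first-order optimality condition: \<open>- p0\<close> is a subgradient at
  \<open>p0\<close>.\<close>

lemma convex_epigraph_minimiser:
  fixes E :: "('b::{real_inner, complete_space} \<times> real) set"
  assumes "closed E" and "convex E" and "E \<noteq> {}"
    and low: "\<And>p t. (p, t) \<in> E \<Longrightarrow> m0 \<le> t + (norm p)\<^sup>2 / 2"
  obtains p0 t0 where "(p0, t0) \<in> E"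
    and "\<And>p t. (p, t) \<in> E \<Longrightarrow> t0 \<le> t + p0 \<bullet> (p - p0)"
proof -
  define g where "g = (\<lambda>(p::'b, t::real). t + (norm p)\<^sup>2 / 2)"
  define m where "m = Inf (g ` E)"
  have bdd: "bdd_below (g ` E)"
    using low by (auto simp: g_def intro!: bdd_belowI[of _ m0])
  have m_le: "m \<le> g e" if "e \<in> E" for e
    unfolding m_def using bdd that by (simp add: cInf_lower)
  have "\<exists>e\<in>E. g e < m + 1 / real (Suc n)" for n
  proof -
    have "Inf (g ` E) < m + 1 / real (Suc n)" by (simp add: m_def)
    then show ?thesis
      using cInf_less_iff[OF _ bdd] \<open>E \<noteq> {}\<close> by auto
  qed
  then obtain e where e: "\<And>n. e n \<in> E" "\<And>n. g (e n) < m + 1 / real (Suc n)"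
    by metis
  define p where "p = (\<lambda>n. fst (e n))"
  define t where "t = (\<lambda>n. snd (e n))"
  have pt: "(p n, t n) \<in> E" "t n + (norm (p n))\<^sup>2 / 2 < m + 1 / real (Suc n)" for n
    using e[of n] by (auto simp: p_def t_def g_def split: prod.splits)
  \<comment> \<open>The midpoint of two almost minimisers lies in \<open>E\<close>, so the
    parallelogram identity bounds their distance by their excess over \<open>m\<close>.\<close>
  have mid: "(norm (p i - p j))\<^sup>2 \<le> 4 / real (Suc i) + 4 / real (Suc j)" for i j
  proof -
    have "(1/2) *\<^sub>R (p i, t i) + (1/2) *\<^sub>R (p j, t j) \<in> E"
      by (rule convexD[OF \<open>convex E\<close> pt(1) pt(1)]) auto
    then have "m \<le> (t i + t j) / 2 + (norm ((1/2) *\<^sub>R (p i + p j)))\<^sup>2 / 2"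
      using m_le by (fastforce simp: g_def add_divide_distrib scaleR_add_right)
    moreover have "(norm ((1/2) *\<^sub>R (p i + p j)))\<^sup>2
        = (norm (p i))\<^sup>2 / 2 + (norm (p j))\<^sup>2 / 2 - (norm (p i - p j))\<^sup>2 / 4"
      by (simp add: power2_norm_eq_inner inner_add inner_diff inner_commute field_simps)
    ultimately have "m \<le> (t i + t j) / 2 + (norm (p i))\<^sup>2 / 4 + (norm (p j))\<^sup>2 / 4 - (norm (p i - p j))\<^sup>2 / 8"
      by argo
    then have "(norm (p i - p j))\<^sup>2 \<le> 4 * (1 / real (Suc i)) + 4 * (1 / real (Suc j))"
      using pt(2)[of i] pt(2)[of j] by argo
    then show ?thesis by simp
  qed
  have "Cauchy p"
  proof (rule metric_CauchyI)
    fix r :: real assume "r > 0"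
    then have "r\<^sup>2 / 8 > 0" by simp
    then obtain N where N: "1 / real (Suc N) < r\<^sup>2 / 8"
      using nat_approx_posE by blast
    have "dist (p i) (p j) < r" if "i \<ge> N" "j \<ge> N" for i j
    proof -
      have "1 / real (Suc i) \<le> 1 / real (Suc N)" "1 / real (Suc j) \<le> 1 / real (Suc N)"
        using that by (auto intro!: divide_left_mono)
      moreover have "4 / real (Suc k) = 4 * (1 / real (Suc k))" for k by simp
      ultimately have "(norm (p i - p j))\<^sup>2 < r\<^sup>2"
        using mid[of i j] N by argo
      then show ?thesis
        using \<open>r > 0\<close> by (simp add: dist_norm power2_less_imp_less)
    qed
    then show "\<exists>N. \<forall>i\<ge>N. \<forall>j\<ge>N. dist (p i) (p j) < r" by blast
  qed
  then obtain p0 where p0: "p \<longlonglongrightarrow> p0"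
    using Cauchy_convergent_iff convergent_def by blast
  define t0 where "t0 = m - (norm p0)\<^sup>2 / 2"
  have "(\<lambda>n. t n + (norm (p n))\<^sup>2 / 2) \<longlonglongrightarrow> m"
  proof (rule tendsto_sandwich[of "\<lambda>_. m" _ _ "\<lambda>n. m + 1 / real (Suc n)"])
    show "\<forall>\<^sub>F n in sequentially. m \<le> t n + (norm (p n))\<^sup>2 / 2"
      using m_le[OF pt(1)] by (simp add: g_def)
    show "\<forall>\<^sub>F n in sequentially. t n + (norm (p n))\<^sup>2 / 2 \<le> m + 1 / real (Suc n)"
      using pt(2) by (simp add: less_imp_le)
    show "(\<lambda>n. m + 1 / real (Suc n)) \<longlonglongrightarrow> m"
      using tendsto_add[OF tendsto_const LIMSEQ_inverse_real_of_nat, of m]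
      by (simp add: inverse_eq_divide)
  qed simp
  from tendsto_diff[OF this tendsto_divide[OF tendsto_power[OF tendsto_norm[OF p0]] tendsto_const, of 2 2]]
  have t: "t \<longlonglongrightarrow> t0" by (simp add: t0_def)
  have in_E: "(p0, t0) \<in> E"
    using closed_sequentially[OF \<open>closed E\<close>, of "\<lambda>n. (p n, t n)"] pt(1) tendsto_Pair[OF p0 t] by blast
  have "t0 \<le> q + p0 \<bullet> (v - p0)" if v: "(v, q) \<in> E" for v q
  proof (rule ccontr)
    assume neg: "\<not> ?thesis"
    define d where "d = t0 - q - p0 \<bullet> (v - p0)"
    define D where "D = (norm (v - p0))\<^sup>2"
    \<comment> \<open>Moving by \<open>s\<close> towards \<open>(v, q)\<close> changes the value by
      \<open>- s * d + s\<^sup>2 * D / 2\<close>, which is negative once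
      \<open>s * D \<le> d\<close>. The \<open>+ 1\<close> guards against
      \<open>D = 0\<close>.\<close>
    define s where "s = min 1 (d / (D + 1))"
    have "d > 0" using neg by (simp add: d_def)
    have "D \<ge> 0" by (simp add: D_def)
    have s: "0 < s" "s \<le> 1" using \<open>d > 0\<close> \<open>D \<ge> 0\<close> by (auto simp: s_def)
    have "s * D \<le> d / (D + 1) * D"
      using \<open>D \<ge> 0\<close> by (intro mult_right_mono) (auto simp: s_def)
    also have "\<dots> \<le> d" using \<open>D \<ge> 0\<close> \<open>d > 0\<close> by (simp add: field_simps)
    finally have sD: "s * D \<le> d" .
    have "(1 - s) *\<^sub>R (p0, t0) + s *\<^sub>R (v, q) \<in> E"
      by (rule convexD[OF \<open>convex E\<close> in_E v]) (use s in auto)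
    from m_le[OF this]
    have "m \<le> (1 - s) * t0 + s * q + (norm ((1 - s) *\<^sub>R p0 + s *\<^sub>R v))\<^sup>2 / 2"
      by (simp add: g_def)
    also have "(norm ((1 - s) *\<^sub>R p0 + s *\<^sub>R v))\<^sup>2 = (norm p0)\<^sup>2 + 2 * s * (p0 \<bullet> (v - p0)) + s\<^sup>2 * D"
      unfolding D_def power2_norm_eq_inner
      by (simp add: inner_add inner_diff inner_commute algebra_simps power2_eq_square)
    finally have "0 \<le> s * (- d + s * D / 2)"
      unfolding t0_def d_def by (simp only: algebra_simps power2_eq_square add_divide_distrib) argo
    then have "d \<le> s * D / 2" using s by (simp add: zero_le_mult_iff)
    then show False using sD \<open>d > 0\<close> by linarith
  qed
  with in_E show thesis by (rule that)
qed

text \<open>A pair monotonically related to the whole graph can be added without losing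
  monotonicity, so maximality puts it there already.\<close>

lemma maximally_monotone_related:
  assumes "maximally_monotone T"
    and "\<And>q v. v \<in> T q \<Longrightarrow> 0 \<le> (p - q) \<bullet> (u - v)"
  shows "u \<in> T p"
proof -
  define S where "S = (\<lambda>r. if r = p then insert u (T r) else T r)"
  have mono: "0 \<le> (a - b) \<bullet> (v - w)" if "v \<in> T a" "w \<in> T b" for a b v w
    using assms(1) that by (auto simp: maximally_monotone_def monotone_operator_def)
  have "0 \<le> (q - p) \<bullet> (v - u)" if "v \<in> T q" for q v
    using assms(2)[OF that] by (simp add: inner_diff algebra_simps)
  then have "monotone_operator S"
    unfolding monotone_operator_def S_def using mono assms(2)
    by (auto split: if_splits)
  moreover have "\<forall>r. T r \<subseteq> S r" by (auto simp: S_def)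
  ultimately have "S = T" using assms(1) by (auto simp: maximally_monotone_def)
  then show ?thesis by (metis S_def insertI1)
qed

lemma maximally_monotoneD:
  assumes "maximally_monotone T" "u \<in> T p" "v \<in> T q"
  shows "0 \<le> (p - q) \<bullet> (u - v)"
  using assms by (auto simp: maximally_monotone_def monotone_operator_def)

text \<open>
  The minimised function is the translated Fitzpatrick function
  \<open>(p, u) \<mapsto> sup {p \<bullet> (v - w) + q \<bullet> u - q \<bullet> (v - w) | v \<in> T q}\<close> plus half the squared norm; testing the
  optimality condition on the graph of \<open>T\<close> produces the required point.
\<close>

theorem Minty:
  fixes T :: "'a::{real_inner, complete_space} \<Rightarrow> 'a set"
  assumes "maximally_monotone T"
  shows "\<exists>p. w - p \<in> T p"
proof -
  define E :: "(('a \<times> 'a) \<times> real) set" where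
    "E = (\<Inter>q. \<Inter>v\<in>T q. {e. (v - w) \<bullet> fst (fst e) + q \<bullet> snd (fst e) - q \<bullet> (v - w) \<le> snd e})"
  have E_iff: "((p, u), t) \<in> E \<longleftrightarrow>
      (\<forall>q. \<forall>v\<in>T q. (v - w) \<bullet> p + q \<bullet> u - q \<bullet> (v - w) \<le> t)" for p u t
    by (simp add: E_def)
  have closed: "closed E"
    unfolding E_def by (intro closed_INT ballI closed_Collect_le continuous_intros)
  have "convex {e::('a \<times> 'a) \<times> real. a \<bullet> fst (fst e) + b \<bullet> snd (fst e) - c \<le> snd e}" for a b c
  proof -
    have "{e::('a \<times> 'a) \<times> real. a \<bullet> fst (fst e) + b \<bullet> snd (fst e) - c \<le> snd e}
        = {e. ((a, b), - 1) \<bullet> e \<le> c}"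
      by (auto simp: inner_prod_def)
    then show ?thesis by (simp add: convex_halfspace_le)
  qed
  then have convex: "convex E"
    unfolding E_def by (intro convex_INT)
  \<comment> \<open>The Fitzpatrick function dominates the duality product: a graph point is tested
    against itself, and for any other point maximality supplies a \<open>(q, v)\<close> violating
    monotonicity.\<close>
  have above: "p \<bullet> u \<le> t" if "((p, u), t) \<in> E" for p u t
  proof (cases "u + w \<in> T p")
    case True
    then show ?thesis using that by (force simp: E_iff inner_diff inner_commute)
  next
    case False
    then obtain q v where v: "v \<in> T q" "(p - q) \<bullet> (u + w - v) < 0"
      using maximally_monotone_related[OF assms] by (meson not_le)
    then have "(v - w) \<bullet> p + q \<bullet> u - q \<bullet> (v - w) \<le> t"
      using that by (simp add: E_iff)
    with v(2) show ?thesis by (simp add: inner_diff inner_add inner_commute algebra_simps)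
  qed
  have graph: "((q, v - w), q \<bullet> (v - w)) \<in> E" if "v \<in> T q" for q v
    unfolding E_iff
  proof (intro allI ballI)
    fix r s assume "s \<in> T r"
    from maximally_monotoneD[OF assms that this]
    show "(s - w) \<bullet> q + r \<bullet> (v - w) - r \<bullet> (s - w) \<le> q \<bullet> (v - w)"
      by (simp add: inner_diff inner_commute algebra_simps)
  qed
  obtain q v where "v \<in> T q"
    using maximally_monotone_related[OF assms] by blast
  then have ne: "E \<noteq> {}" using graph by blast
  have "0 \<le> t + (norm p)\<^sup>2 / 2" if "(p, t) \<in> E" for p t
  proof -
    obtain a b where p: "p = (a, b)" by fastforce
    have "0 \<le> (norm (a + b))\<^sup>2 / 2" by simp
    also have "\<dots> = a \<bullet> b + (norm p)\<^sup>2 / 2"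
      unfolding power2_norm_eq_inner p by (simp add: inner_add inner_commute field_simps)
    finally show ?thesis using above that p by fastforce
  qed
  with closed convex ne obtain e0 t0 where e0: "(e0, t0) \<in> E"
    and opt: "\<And>e t. (e, t) \<in> E \<Longrightarrow> t0 \<le> t + e0 \<bullet> (e - e0)"
    using convex_epigraph_minimiser[of E 0] by blast
  obtain p u where pu: "e0 = (p, u)" by fastforce
  have "p \<bullet> u \<le> t0" using above e0 pu by blast
  \<comment> \<open>Optimality tested at a graph point, with \<open>p \<bullet> u\<close> added on
    both sides to complete the square.\<close>
  have key: "(norm (p + u))\<^sup>2 \<le> (q + u) \<bullet> (v - w + p)" if "v \<in> T q" for q v
    using opt[OF graph[OF that]] \<open>p \<bullet> u \<le> t0\<close> unfolding pu power2_norm_eq_inner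
    by (simp add: inner_add inner_diff inner_commute algebra_simps)
  have "w - p \<in> T (- u)"
  proof (rule maximally_monotone_related[OF assms])
    fix q v assume "v \<in> T q"
    have "0 \<le> (norm (p + u))\<^sup>2" by simp
    also note key[OF \<open>v \<in> T q\<close>]
    finally show "0 \<le> (- u - q) \<bullet> (w - p - v)"
      by (simp add: inner_add inner_diff inner_commute algebra_simps)
  qed
  \<comment> \<open>Testing \<open>key\<close> at the point just found makes \<open>q + u\<close>
    vanish, which leaves \<open>p + u = 0\<close>.\<close>
  moreover from key[OF this] have "- u = p" by (simp add: neg_eq_iff_add_eq_0 add.commute)
  ultimately show ?thesis by auto
qed

section \<open>Resolvents and scaled operators\<close>

lemma resolvent_inclusion_unique:
  assumes "maximally_monotone T" "w - p \<in> T p" "w - q \<in> T q"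
  shows "p = q"
proof -
  have "0 \<le> (p - q) \<bullet> (w - p - (w - q))"
    by (rule maximally_monotoneD[OF assms])
  also have "w - p - (w - q) = - (p - q)" by simp
  finally have "(p - q) \<bullet> (p - q) \<le> 0" unfolding inner_minus_right by simp
  then show ?thesis by (simp add: inner_ge_zero order_antisym_conv)
qed

text \<open>Minty's theorem gives existence and monotonicity uniqueness, so the definite description
  denotes and each resolvent step becomes an inclusion.\<close>

lemma resolvent_eq_iff:
  fixes T :: "'a::{real_inner, complete_space} \<Rightarrow> 'a set"
  assumes "maximally_monotone T"
  shows "resolvent T w = p \<longleftrightarrow> w - p \<in> T p"
proof -
  have "p \<in> operator_inverse (\<lambda>p. {p} + T p) w \<longleftrightarrow> w - p \<in> T p" for p
    by (force simp: operator_inverse_def set_plus_def)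
  then have eq: "resolvent T w = (THE p. w - p \<in> T p)" by (simp add: resolvent_def)
  have "\<exists>!p. w - p \<in> T p"
    using Minty[OF assms, of w] resolvent_inclusion_unique[OF assms] by blast
  then show ?thesis
    unfolding eq using theI'[of "\<lambda>p. w - p \<in> T p"] by blast
qed

lemma maximally_monotone_scale:
  assumes "maximally_monotone T" "c > 0"
  shows "maximally_monotone (scale_operator c T)"
proof -
  have iff: "u \<in> scale_operator c T p \<longleftrightarrow> (1 / c) *\<^sub>R u \<in> T p" for u p
    using \<open>c > 0\<close> by (force simp: scale_operator_def image_iff)
  have "scale_operator c T p = S p"
    if S: "monotone_operator S" "\<forall>p. scale_operator c T p \<subseteq> S p" for S p
  proof (intro equalityI subsetI)
    fix u assume "u \<in> S p"
    have "(1 / c) *\<^sub>R u \<in> T p"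
    proof (rule maximally_monotone_related[OF assms(1)])
      fix q v assume "v \<in> T q"
      then have "c *\<^sub>R v \<in> S q" using S(2) by (auto simp: scale_operator_def)
      then have "0 \<le> (p - q) \<bullet> (u - c *\<^sub>R v)"
        using S(1) \<open>u \<in> S p\<close> by (auto simp: monotone_operator_def)
      also have "u - c *\<^sub>R v = c *\<^sub>R ((1 / c) *\<^sub>R u - v)"
        using \<open>c > 0\<close> by (simp add: scaleR_diff_right)
      finally show "0 \<le> (p - q) \<bullet> ((1 / c) *\<^sub>R u - v)"
        using \<open>c > 0\<close> by (simp add: zero_le_mult_iff)
    qed
    then show "u \<in> scale_operator c T p" by (simp add: iff)
  qed (use S(2) in auto)
  moreover have "monotone_operator (scale_operator c T)"
    unfolding monotone_operator_def
  proof (intro allI ballI)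
    fix p q u v assume "u \<in> scale_operator c T p" "v \<in> scale_operator c T q"
    then obtain u' v' where "u = c *\<^sub>R u'" "v = c *\<^sub>R v'" "u' \<in> T p" "v' \<in> T q"
      by (auto simp: scale_operator_def)
    then show "0 \<le> (p - q) \<bullet> (u - v)"
      using maximally_monotoneD[OF assms(1), of u' p v' q] \<open>c > 0\<close>
      by (simp flip: scaleR_diff_right)
  qed
  ultimately show ?thesis unfolding maximally_monotone_def by (metis ext)
qed

section \<open>Weak convergence\<close>

text \<open>Minimising \<open>(norm p)\<^sup>2 / 2 - f p\<close> over \<open>M\<close> produces
  \<open>l\<close>; optimality in the directions \<open>p\<close> and \<open>- p\<close> gives
  equality. Linearity is asked on \<open>M\<close> because the functional needed for weak
  compactness is a limit that exists only there.\<close>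

lemma Riesz_subspace:
  fixes M :: "'a::{real_inner, complete_space} set"
  assumes "closed M" "subspace M"
    and add: "\<And>p q. p \<in> M \<Longrightarrow> q \<in> M \<Longrightarrow> f (p + q) = f p + f q"
    and scale: "\<And>c p. p \<in> M \<Longrightarrow> f (c *\<^sub>R p) = c * f p"
    and bound: "\<And>p. p \<in> M \<Longrightarrow> \<bar>f p\<bar> \<le> K * norm p"
  shows "\<exists>l\<in>M. \<forall>p\<in>M. l \<bullet> p = f p"
proof -
  have diff: "f (p - q) = f p - f q" if "p \<in> M" "q \<in> M" for p q
    using add[of p "(- 1) *\<^sub>R q"] scale[of q "- 1"] that \<open>subspace M\<close>
    by (simp add: subspace_neg)
  define E where "E = {(p, t). p \<in> M \<and> - f p \<le> t}"
  have "closed E"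
    unfolding closed_sequential_limits
  proof (intro allI impI, elim conjE)
    fix e l assume e: "\<forall>n. e n \<in> E" "e \<longlonglongrightarrow> l"
    define p where "p = (\<lambda>n. fst (e n))"
    have p: "p n \<in> M" "- f (p n) \<le> snd (e n)" for n
      using e(1)[rule_format, of n] by (auto simp: E_def p_def)
    have lim: "p \<longlonglongrightarrow> fst l" "(\<lambda>n. snd (e n)) \<longlonglongrightarrow> snd l"
      unfolding p_def using e(2) by (auto intro: tendsto_fst tendsto_snd)
    have lM: "fst l \<in> M" using closed_sequentially[OF \<open>closed M\<close>] p(1) lim(1) by blast
    have "(\<lambda>n. K * norm (p n - fst l)) \<longlonglongrightarrow> 0"
      by (intro tendsto_mult_right_zero tendsto_norm_zero LIM_zero lim)
    moreover have "norm (f (p n) - f (fst l)) \<le> K * norm (p n - fst l)" for n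
      using bound[OF subspace_diff[OF \<open>subspace M\<close> p(1) lM], of n] diff[OF p(1) lM] by simp
    then have "\<forall>\<^sub>F n in sequentially. norm (f (p n) - f (fst l)) \<le> K * norm (p n - fst l)"
      by (rule always_eventually[OF allI])
    ultimately have "(\<lambda>n. f (p n) - f (fst l)) \<longlonglongrightarrow> 0"
      by (rule Lim_null_comparison[rotated])
    then have "(\<lambda>n. f (p n)) \<longlonglongrightarrow> f (fst l)" by (rule LIM_zero_cancel)
    from LIMSEQ_le[OF tendsto_minus[OF this] lim(2)] have "- f (fst l) \<le> snd l"
      using p(2) by blast
    then show "l \<in> E" using lM by (auto simp: E_def split: prod.splits)
  qed
  moreover have "convex E"
    unfolding convex_def
  proof (intro ballI allI impI)
    fix d e :: "'a \<times> real" and a b :: real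
    assume *: "d \<in> E" "e \<in> E" "0 \<le> a" "0 \<le> b" "a + b = 1"
    obtain p s q t where [simp]: "d = (p, s)" "e = (q, t)" by fastforce
    have M: "p \<in> M" "q \<in> M" "- f p \<le> s" "- f q \<le> t" using * by (auto simp: E_def)
    have "a * (- f p) + b * (- f q) \<le> a * s + b * t"
      using M * by (intro add_mono mult_left_mono) auto
    then show "a *\<^sub>R d + b *\<^sub>R e \<in> E"
      using M \<open>subspace M\<close> by (simp add: E_def add scale subspace_add subspace_scale)
  qed
  moreover have "(0, 0) \<in> E"
    using \<open>subspace M\<close> scale[of 0 0] by (auto simp: E_def subspace_0)
  then have "E \<noteq> {}" by blast
  moreover have "- (K\<^sup>2 / 2) \<le> t + (norm p)\<^sup>2 / 2" if "(p, t) \<in> E" for p t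
  proof -
    have "- (K * norm p) \<le> t" using that bound[of p] by (auto simp: E_def)
    moreover have "0 \<le> (norm p - K)\<^sup>2" by simp
    ultimately show ?thesis by (simp add: power2_diff algebra_simps)
  qed
  ultimately obtain l t where l: "(l, t) \<in> E"
    and opt: "\<And>p s. (p, s) \<in> E \<Longrightarrow> t \<le> s + l \<bullet> (p - l)"
    using convex_epigraph_minimiser[of E] by blast
  have lM: "l \<in> M" and "- f l \<le> t" using l by (auto simp: E_def)
  have le: "f p \<le> l \<bullet> p" if "p \<in> M" for p
  proof -
    have "(l + p, - f (l + p)) \<in> E"
      using that lM \<open>subspace M\<close> by (simp add: E_def subspace_add)
    from opt[OF this] show ?thesis using \<open>- f l \<le> t\<close> add[OF lM that] by simp
  qed
  have "l \<bullet> p = f p" if "p \<in> M" for p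
    using le[OF that] le[of "(- 1) *\<^sub>R p"] scale[OF that, of "- 1"] that \<open>subspace M\<close>
    by (simp add: subspace_neg)
  with lM show ?thesis by blast
qed

text \<open>Here \<open>l\<close> is the orthogonal projection of \<open>u\<close> onto
  \<open>M\<close>.\<close>

lemma Riesz_subspace_projection:
  fixes M :: "'a::{real_inner, complete_space} set"
  assumes "closed M" "subspace M"
  shows "\<exists>l\<in>M. \<forall>p\<in>M. l \<bullet> p = u \<bullet> p"
  by (rule Riesz_subspace[OF assms, where K = "norm u"])
    (auto simp: inner_add Cauchy_Schwarz_ineq2)

text \<open>A diagonal argument makes the products with every \<open>X m\<close> converge. The
  vectors whose products converge form a closed subspace \<open>M\<close> on which the limit
  functional is represented by some \<open>l\<close>.\<close>

theorem weakly_convergent_subsequence: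
  fixes X :: "nat \<Rightarrow> 'a::{real_inner, complete_space}"
  assumes "bounded (range X)"
  obtains r l where "strict_mono (r :: nat \<Rightarrow> nat)" "weakly_converges (X \<circ> r) l"
proof -
  obtain K where K: "\<And>n. norm (X n) \<le> K" "K > 0"
    using assms by (auto simp: bounded_pos)
  have bd: "\<bar>X n \<bullet> v\<bar> \<le> K * norm v" for n v
    using Cauchy_Schwarz_ineq2[of "X n" v] K by (meson order_trans mult_right_mono norm_ge_zero)
  interpret subseqs "\<lambda>m s. convergent (\<lambda>n. X (s n) \<bullet> X m)"
  proof
    fix m :: nat and s :: "nat \<Rightarrow> nat"
    have "bounded (range (\<lambda>n. X (s n) \<bullet> X m))"
      unfolding bounded_iff using bd by (auto intro!: exI[of _ "K * norm (X m)"])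
    from bounded_imp_convergent_subsequence[OF this]
    show "\<exists>r. strict_mono r \<and> convergent (\<lambda>n. X ((s \<circ> r) n) \<bullet> X m)"
      by (auto simp: convergent_def o_def)
  qed
  define r where "r = diagseq"
  have r: "strict_mono r" by (simp add: r_def subseq_diagseq)
  \<comment> \<open>The diagonal sequence follows the subsequence chosen for \<open>X m\<close> only
    from index \<open>Suc m\<close> on.\<close>
  have "convergent (\<lambda>n. X ((diagseq \<circ> (+) (Suc m)) n) \<bullet> X m)" for m

  proof (rule diagseq_holds)
    fix a b :: "nat \<Rightarrow> nat" and n
    assume "strict_mono a" "convergent (\<lambda>k. X (b k) \<bullet> X n)"
    from convergent_subseq_convergent[OF this(2,1)]
    show "convergent (\<lambda>k. X ((b \<circ> a) k) \<bullet> X n)" by (simp add: o_def)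
  qed
  then have conv_X: "convergent (\<lambda>n. X (r n) \<bullet> X m)" for m
    using convergent_ignore_initial_segment[of "\<lambda>n. X (r n) \<bullet> X m" "Suc m" for m]
    by (simp add: r_def add.commute)
  define M where "M = {v. convergent (\<lambda>n. X (r n) \<bullet> v)}"
  define f where "f = (\<lambda>v. lim (\<lambda>n. X (r n) \<bullet> v))"
  have f: "(\<lambda>n. X (r n) \<bullet> v) \<longlonglongrightarrow> f v" if "v \<in> M" for v
    using that by (simp add: M_def f_def convergent_LIMSEQ_iff)
  have MI: "v \<in> M" "f v = a" if "(\<lambda>n. X (r n) \<bullet> v) \<longlonglongrightarrow> a" for v a
    using that by (auto simp: M_def f_def convergent_def limI)
  have add: "(\<lambda>n. X (r n) \<bullet> (u + v)) \<longlonglongrightarrow> f u + f v" if "u \<in> M" "v \<in> M" for u v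
    unfolding inner_add_right by (intro tendsto_add f that)
  have scale: "(\<lambda>n. X (r n) \<bullet> (c *\<^sub>R v)) \<longlonglongrightarrow> c * f v" if "v \<in> M" for c v
    unfolding inner_scaleR_right by (intro tendsto_mult_left f that)
  have "subspace M"
    unfolding subspace_def using MI(1)[OF add] MI(1)[OF scale] MI(1)[of 0 0] by auto
  \<comment> \<open>Boundedness of \<open>X\<close> makes the products with \<open>v\<close> and
    with a nearby \<open>V k\<close> uniformly close, so the Cauchy property passes to
    \<open>v\<close>.\<close>
  have "closed M"
    unfolding closed_sequential_limits
  proof (intro allI impI, elim conjE)
    fix V v assume V: "\<forall>k. V k \<in> M" "V \<longlonglongrightarrow> v"
    have "Cauchy (\<lambda>n. X (r n) \<bullet> v)"
    proof (rule metric_CauchyI)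
      fix e :: real assume "e > 0"
      then have "e / (4 * K) > 0" using K(2) by simp
      then obtain k where k: "dist (V k) v < e / (4 * K)"
        using V(2) metric_LIMSEQ_D by blast
      have "Cauchy (\<lambda>n. X (r n) \<bullet> V k)"
        using V(1) by (simp add: M_def Cauchy_convergent_iff)
      then obtain N where N: "\<And>i j. i \<ge> N \<Longrightarrow> j \<ge> N \<Longrightarrow> dist (X (r i) \<bullet> V k) (X (r j) \<bullet> V k) < e / 2"
        using \<open>e > 0\<close> by (meson half_gt_zero metric_CauchyD)
      have small: "\<bar>X n \<bullet> v - X n \<bullet> V k\<bar> < e / 4" for n
      proof -
        have "\<bar>X n \<bullet> v - X n \<bullet> V k\<bar> \<le> K * norm (v - V k)"
          using bd[of n "v - V k"] by (simp add: inner_diff)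
        also have "\<dots> < e / 4"
          using k K(2) by (simp add: dist_norm norm_minus_commute field_simps)
        finally show ?thesis .
      qed
      have "dist (X (r i) \<bullet> v) (X (r j) \<bullet> v) < e" if "i \<ge> N" "j \<ge> N" for i j
        using N[OF that] small[of "r i"] small[of "r j"] unfolding dist_real_def by linarith
      then show "\<exists>N. \<forall>i\<ge>N. \<forall>j\<ge>N. dist (X (r i) \<bullet> v) (X (r j) \<bullet> v) < e" by blast
    qed
    then show "v \<in> M" by (simp add: M_def Cauchy_convergent_iff)
  qed
  have "\<bar>f v\<bar> \<le> K * norm v" if "v \<in> M" for v
    using LIMSEQ_le_const2[OF tendsto_rabs[OF f[OF that]]] bd by blast
  then obtain l where l: "l \<in> M" "\<And>v. v \<in> M \<Longrightarrow> l \<bullet> v = f v"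
    using Riesz_subspace[OF \<open>closed M\<close> \<open>subspace M\<close> MI(2)[OF add] MI(2)[OF scale], of K] by blast
  have "weakly_converges (X \<circ> r) l"
    unfolding weakly_converges_def
  proof
    fix u
    \<comment> \<open>All \<open>X m\<close> and \<open>l\<close> lie in \<open>M\<close>, so
      projecting \<open>u\<close> to \<open>v\<close> changes no product.\<close>
    obtain v where v: "v \<in> M" "\<And>p. p \<in> M \<Longrightarrow> v \<bullet> p = u \<bullet> p"
      using Riesz_subspace_projection[OF \<open>closed M\<close> \<open>subspace M\<close>] by metis
    have "X m \<in> M" for m using conv_X by (simp add: M_def)
    then have "X (r n) \<bullet> v = X (r n) \<bullet> u" for n
      using v(2) by (metis inner_commute)
    moreover have "f v = l \<bullet> u" using l v by (metis inner_commute)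
    ultimately show "(\<lambda>n. (X \<circ> r) n \<bullet> u) \<longlonglongrightarrow> l \<bullet> u"
      using f[OF v(1)] by simp
  qed
  with r show thesis by (rule that)
qed

text \<open>Otherwise a subsequence keeps its product with some \<open>u\<close> away from
  \<open>l \<bullet> u\<close>, yet it has a weakly convergent further subsequence, whose limit is
  \<open>l\<close> by \<open>lim\<close>.\<close>

lemma weakly_converges_of_subsequences:
  fixes X :: "nat \<Rightarrow> 'a::{real_inner, complete_space}"
  assumes "bounded (range X)"
    and lim: "\<And>r l'. strict_mono (r :: nat \<Rightarrow> nat) \<Longrightarrow> weakly_converges (X \<circ> r) l' \<Longrightarrow> l' = l"
  shows "weakly_converges X l"
  unfolding weakly_converges_def
proof (rule allI, rule ccontr)
  fix u assume "\<not> (\<lambda>n. X n \<bullet> u) \<longlonglongrightarrow> l \<bullet> u"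
  then obtain e where "e > 0" and e: "\<And>N. \<exists>n\<ge>N. \<not> dist (X n \<bullet> u) (l \<bullet> u) < e"
    unfolding lim_sequentially by blast
  then have "infinite {n. \<not> dist (X n \<bullet> u) (l \<bullet> u) < e}"
    by (auto simp: infinite_nat_iff_unbounded_le)
  then obtain s :: "nat \<Rightarrow> nat" where s: "strict_mono s" "\<And>n. \<not> dist (X (s n) \<bullet> u) (l \<bullet> u) < e"
    using infinite_enumerate by blast
  have "bounded (range (X \<circ> s))"
    by (rule bounded_subset[OF assms(1)]) auto
  then obtain r l' where r: "strict_mono r" "weakly_converges ((X \<circ> s) \<circ> r) l'"
    by (rule weakly_convergent_subsequence)
  then have "l' = l"
    using lim[of "s \<circ> r"] s(1) by (simp add: strict_mono_o o_assoc)
  then have "(\<lambda>n. X (s (r n)) \<bullet> u) \<longlonglongrightarrow> l \<bullet> u"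
    using r(2) by (simp add: weakly_converges_def)
  then show False
    using s(2) \<open>e > 0\<close> by (meson lim_sequentially order_refl)
qed

text \<open>The difference of the squared distances to two weak cluster points is affine in
  \<open>X n\<close> and converges; its limit computed along both subsequences forces the points to
  agree.\<close>

theorem Opial:
  fixes X :: "nat \<Rightarrow> 'a::{real_inner, complete_space}"
  assumes "bounded (range X)"
    and conv: "\<And>p. p \<in> F \<Longrightarrow> convergent (\<lambda>n. (norm (X n - p))\<^sup>2)"
    and clus: "\<And>r l. strict_mono (r :: nat \<Rightarrow> nat) \<Longrightarrow> weakly_converges (X \<circ> r) l \<Longrightarrow> l \<in> F"
  obtains l where "l \<in> F" "weakly_converges X l"
proof -
  obtain r l where r: "strict_mono r" "weakly_converges (X \<circ> r) l"
    using weakly_convergent_subsequence[OF assms(1)] by blast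
  have "l' = l" if r': "strict_mono r'" "weakly_converges (X \<circ> r') l'" for r' l'
  proof -
    have "l \<in> F" "l' \<in> F" using clus r r' by blast+
    then have "convergent (\<lambda>n. (norm (X n - l'))\<^sup>2 - (norm (X n - l))\<^sup>2)"
      by (intro convergent_diff conv)
    moreover have "(norm (X n - l'))\<^sup>2 - (norm (X n - l))\<^sup>2
        = 2 * (X n \<bullet> (l - l')) + ((norm l')\<^sup>2 - (norm l)\<^sup>2)" for n
      by (simp add: power2_norm_eq_inner inner_diff inner_commute algebra_simps)
    ultimately obtain a where a: "(\<lambda>n. 2 * (X n \<bullet> (l - l')) + ((norm l')\<^sup>2 - (norm l)\<^sup>2)) \<longlonglongrightarrow> a"
      by (auto simp: convergent_def)
    have "2 * (p \<bullet> (l - l')) + ((norm l')\<^sup>2 - (norm l)\<^sup>2) = a"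
      if "strict_mono s" "weakly_converges (X \<circ> s) p" for s p
    proof (rule LIMSEQ_unique)
      show "(\<lambda>n. 2 * (X (s n) \<bullet> (l - l')) + ((norm l')\<^sup>2 - (norm l)\<^sup>2)) \<longlonglongrightarrow> a"
        using LIMSEQ_subseq_LIMSEQ[OF a that(1)] by (simp add: o_def)
      show "(\<lambda>n. 2 * (X (s n) \<bullet> (l - l')) + ((norm l')\<^sup>2 - (norm l)\<^sup>2))
          \<longlonglongrightarrow> 2 * (p \<bullet> (l - l')) + ((norm l')\<^sup>2 - (norm l)\<^sup>2)"
        using that(2)[unfolded weakly_converges_def o_def, rule_format, of "l - l'"]
        by (intro tendsto_add tendsto_mult_left tendsto_const)
    qed
    from this[OF r] this[OF r'] have "(l - l') \<bullet> (l - l') = 0"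
      by (simp add: inner_diff_left)
    then show ?thesis by simp
  qed
  then have "weakly_converges X l"
    using weakly_converges_of_subsequences[OF assms(1)] by blast
  moreover have "l \<in> F" using clus r by blast
  ultimately show thesis using that by blast
qed

lemma weakly_converges_subseq:
  assumes "weakly_converges X l" "strict_mono r"
  shows "weakly_converges (X \<circ> r) l"
  using LIMSEQ_subseq_LIMSEQ[OF assms(1)[unfolded weakly_converges_def, rule_format] assms(2)]
  by (simp add: weakly_converges_def o_def)

lemma inner_bounded_null:
  fixes f g :: "nat \<Rightarrow> 'a::real_inner"
  assumes "bounded (range f)" "g \<longlonglongrightarrow> 0"
  shows "(\<lambda>n. f n \<bullet> g n) \<longlonglongrightarrow> 0"
proof -
  obtain K where K: "\<And>n. norm (f n) \<le> K" using assms(1) by (auto simp: bounded_iff)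
  have "norm (f n \<bullet> g n) \<le> K * norm (g n)" for n
    using Cauchy_Schwarz_ineq2[of "f n" "g n"] mult_right_mono[OF K norm_ge_zero] by (metis order_trans real_norm_def)
  then have "\<forall>\<^sub>F n in sequentially. norm (f n \<bullet> g n) \<le> K * norm (g n)"
    by (rule always_eventually[OF allI])
  moreover have "(\<lambda>n. K * norm (g n)) \<longlonglongrightarrow> 0"
    by (intro tendsto_mult_right_zero tendsto_norm_zero assms)
  ultimately show ?thesis by (rule Lim_null_comparison)
qed

section \<open>The Lyapunov function of the iteration\<close>

text \<open>\<open>U\<close>, \<open>P\<close>, \<open>Q\<close>, \<open>G\<close> stand for
  differences of \<open>z\<close>, \<open>x\<close>, \<open>y\<close> and values of
  \<open>B\<close>; the hypotheses express monotonicity of \<open>A\<close> and \<open>C\<close>.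
  Twice their sum is exactly the gap between the two sides.\<close>

lemma monotone_pair_energy:
  fixes P Q U G :: "'a::real_inner"
  assumes "0 \<le> P \<bullet> (U - P)" "0 \<le> Q \<bullet> (2 *\<^sub>R P - U - Q - G)"
  shows "(norm (U + (Q - P)))\<^sup>2 \<le> (norm U)\<^sup>2 - (norm (Q - P))\<^sup>2 - 2 * (Q \<bullet> G)"
  using assms unfolding power2_norm_eq_inner
  by (simp add: inner_add inner_diff inner_commute algebra_simps)

text \<open>The bound on \<open>Q\<close> composes two nonexpansive maps: the reflected resolvent of
  \<open>A\<close>, with output \<open>2 *\<^sub>R P - U\<close>, and the resolvent of
  \<open>C\<close>.\<close>

lemma monotone_pair_bound:
  fixes P Q U G :: "'a::real_inner"
  assumes "0 \<le> P \<bullet> (U - P)" "0 \<le> Q \<bullet> (2 *\<^sub>R P - U - Q - G)"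
  shows "norm P \<le> norm U" "norm Q \<le> norm U + norm G"
proof -
  have "norm P * norm P \<le> norm P * norm U"
    using assms(1) norm_cauchy_schwarz[of P U] by (simp add: inner_diff norm_eq_sqrt_inner)
  then show "norm P \<le> norm U"
    by (metis linorder_not_le mult_le_cancel_left_pos norm_ge_zero order_le_less_trans)
  have "(norm (2 *\<^sub>R P - U))\<^sup>2 \<le> (norm U)\<^sup>2"
    using assms(1) unfolding power2_norm_eq_inner
    by (simp add: inner_diff inner_commute algebra_simps)
  then have *: "norm (2 *\<^sub>R P - U) \<le> norm U" by (rule power2_le_imp_le) simp
  have "norm Q * norm Q \<le> Q \<bullet> (2 *\<^sub>R P - U - G)"
    using assms(2) by (simp add: inner_diff power2_norm_eq_inner[symmetric] power2_eq_square)
  also have "\<dots> \<le> norm Q * norm (2 *\<^sub>R P - U - G)" by (rule norm_cauchy_schwarz)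
  also have "\<dots> \<le> norm Q * (norm U + norm G)"
    using * norm_triangle_ineq4[of "2 *\<^sub>R P - U" G] by (intro mult_left_mono) auto
  finally show "norm Q \<le> norm U + norm G"
    by (metis add_nonneg_nonneg linorder_not_le mult_le_cancel_left_pos norm_ge_zero order_le_less_trans)
qed

text \<open>
  The sequence \<open>Y\<close> is shifted by two: \<open>Y n\<close> stands for \<open>y (n - 2)\<close>, so \<open>W k\<close> is the paper's \<open>2 y (k-1) - y (k-2)\<close>.
\<close>

locale brfb =
  fixes A C :: "'a::{real_inner, complete_space} \<Rightarrow> 'a set"
    and B :: "'a \<Rightarrow> 'a" and tau :: real
    and x z Y :: "nat \<Rightarrow> 'a"
  assumes A: "maximally_monotone A" and C: "maximally_monotone C"
    and B: "monotone_operator (\<lambda>p. {B p})"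
    and lip: "norm (B p - B q) \<le> tau * norm (p - q)"
    and tau: "0 \<le> tau" "tau \<le> 1 / 22"
    and x: "z k - x k \<in> A (x k)"
    and Y: "2 *\<^sub>R x k - z k - B (2 *\<^sub>R Y (Suc k) - Y k) - Y (Suc (Suc k)) \<in> C (Y (Suc (Suc k)))"
    and z: "z (Suc k) = z k + (Y (Suc (Suc k)) - x k)"
begin

definition W where "W k = 2 *\<^sub>R Y (Suc k) - Y k"
definition e where "e k = norm (z (Suc k) - z k)"
definition S where "S k = norm (Y (Suc k) - Y k)"
text \<open>The iteration is stationary at such a pair: \<open>xs\<close> is the resolvent of
  \<open>A\<close> at \<open>zs\<close> and of \<open>C\<close> at
  \<open>2 *\<^sub>R xs - zs - B xs\<close>. Adding the inclusions shows that \<open>xs\<close> is a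
  zero of the sum.\<close>

definition fixed_pair where
  "fixed_pair zs xs \<longleftrightarrow> zs - xs \<in> A xs \<and> xs - zs - B xs \<in> C xs"
definition \<phi> where "\<phi> xs k = (Y (Suc (Suc k)) - Y (Suc k)) \<bullet> (B (W k) - B xs)"

text \<open>
  The weight of \<open>(e k)\<^sup>2\<close> must lie between twice that of \<open>(S (Suc k))\<^sup>2\<close>, since \<open>(S (Suc (Suc k)))\<^sup>2\<close> is bounded
  by \<open>2 * (e k)\<^sup>2\<close> plus small terms, and 1.
\<close>

definition V where
  "V zs xs k = (norm (z (Suc k) - zs))\<^sup>2 + 2 * \<phi> xs k
     + 2 / 5 * (S (Suc k))\<^sup>2 + 1 / 10 * (S k)\<^sup>2 + 9 / 10 * (e k)\<^sup>2"

lemma B_monotone: "0 \<le> (p - q) \<bullet> (B p - B q)"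
  using B by (auto simp: monotone_operator_def)

lemma W_lip: "norm (B (W (Suc k)) - B (W k)) \<le> tau * (2 * S (Suc k) + S k)"
proof -
  have "W (Suc k) - W k = 2 *\<^sub>R (Y (Suc (Suc k)) - Y (Suc k)) - (Y (Suc k) - Y k)"
    by (simp add: W_def algebra_simps scaleR_2)
  then have "norm (W (Suc k) - W k) \<le> 2 * S (Suc k) + S k"
    unfolding S_def by (metis norm_triangle_ineq4 norm_scaleR abs_numeral)
  then show ?thesis
    using lip[of "W (Suc k)" "W k"] tau(1) by (meson mult_left_mono order_trans)
qed

lemma Y_minus_W: "Y (Suc (Suc k)) - W k = (Y (Suc (Suc k)) - Y (Suc k)) - (Y (Suc k) - Y k)"
  by (simp add: W_def algebra_simps scaleR_2)

lemma fixed_pair_pairs: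
  assumes "fixed_pair zs xs"
  shows "0 \<le> (x k - xs) \<bullet> ((z k - zs) - (x k - xs))"
    and "0 \<le> (Y (Suc (Suc k)) - xs) \<bullet> (2 *\<^sub>R (x k - xs) - (z k - zs) - (Y (Suc (Suc k)) - xs) - (B (W k) - B xs))"
proof -
  show "0 \<le> (x k - xs) \<bullet> ((z k - zs) - (x k - xs))"
    using maximally_monotoneD[OF A x[of k], of "zs - xs" xs] assms
    by (simp add: fixed_pair_def algebra_simps)
  have "2 *\<^sub>R (x k - xs) - (z k - zs) - (Y (Suc (Suc k)) - xs) - (B (W k) - B xs)
      = 2 *\<^sub>R x k - z k - B (W k) - Y (Suc (Suc k)) - (xs - zs - B xs)"
    by (simp add: algebra_simps scaleR_2)
  then show "0 \<le> (Y (Suc (Suc k)) - xs) \<bullet> (2 *\<^sub>R (x k - xs) - (z k - zs) - (Y (Suc (Suc k)) - xs) - (B (W k) - B xs))"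
    using maximally_monotoneD[OF C Y[of k], of "xs - zs - B xs" xs] assms
    by (simp only: fixed_pair_def W_def)
qed

lemma x_bound: "fixed_pair zs xs \<Longrightarrow> norm (x k - xs) \<le> norm (z k - zs)"
  using monotone_pair_bound(1)[OF fixed_pair_pairs] .

text \<open>\<open>monotone_pair_bound\<close> is applied to differences of consecutive iterations
  instead of differences from a fixed pair.\<close>

lemma S_bound: "S (Suc (Suc k)) \<le> e k + tau * (2 * S (Suc k) + S k)"
proof -
  let ?P = "x (Suc k) - x k" and ?U = "z (Suc k) - z k" and ?Q = "Y (Suc (Suc (Suc k))) - Y (Suc (Suc k))"
    and ?G = "B (W (Suc k)) - B (W k)"
  have 1: "0 \<le> ?P \<bullet> (?U - ?P)"
    using maximally_monotoneD[OF A x[of "Suc k"] x[of k]] by (simp add: algebra_simps)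
  have "2 *\<^sub>R ?P - ?U - ?Q - ?G
      = 2 *\<^sub>R x (Suc k) - z (Suc k) - B (W (Suc k)) - Y (Suc (Suc (Suc k)))
        - (2 *\<^sub>R x k - z k - B (W k) - Y (Suc (Suc k)))"
    by (simp add: algebra_simps scaleR_2)
  then have 2: "0 \<le> ?Q \<bullet> (2 *\<^sub>R ?P - ?U - ?Q - ?G)"
    using maximally_monotoneD[OF C Y[of "Suc k"] Y[of k]] by (simp only: W_def)
  from monotone_pair_bound(2)[OF 1 2] W_lip[of k] show ?thesis
    by (simp add: S_def e_def)
qed

text \<open>The product with \<open>?G\<close> is split at \<open>W (Suc k)\<close>. One part is
  nonnegative by monotonicity of \<open>B\<close>; in the other, \<open>Y_minus_W\<close> yields
  consecutive values of \<open>\<phi>\<close> and a product of increments bounded by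
  \<open>W_lip\<close>.\<close>

lemma energy:
  assumes "fixed_pair zs xs"
  shows "(norm (z (Suc (Suc k)) - zs))\<^sup>2 + 2 * \<phi> xs (Suc k)
    \<le> (norm (z (Suc k) - zs))\<^sup>2 + 2 * \<phi> xs k - (e (Suc k))\<^sup>2
      + 2 * tau * S (Suc k) * (2 * S (Suc k) + S k)"
proof -
  let ?y = "Y (Suc (Suc (Suc k)))" and ?G = "B (W (Suc k)) - B xs"
    and ?D = "Y (Suc (Suc k)) - Y (Suc k)"
  have d: "z (Suc (Suc k)) - z (Suc k) = (?y - xs) - (x (Suc k) - xs)"
    using z[of "Suc k"] by simp
  have zz: "z (Suc (Suc k)) - zs = (z (Suc k) - zs) + ((?y - xs) - (x (Suc k) - xs))"
    using d by (simp add: algebra_simps)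
  have 1: "(norm (z (Suc (Suc k)) - zs))\<^sup>2
      \<le> (norm (z (Suc k) - zs))\<^sup>2 - (e (Suc k))\<^sup>2 - 2 * ((?y - xs) \<bullet> ?G)"
    using monotone_pair_energy[OF fixed_pair_pairs[OF assms, of "Suc k"]]
    unfolding zz e_def d .
  have "(?y - xs) \<bullet> ?G = (W (Suc k) - xs) \<bullet> ?G + (?y - W (Suc k)) \<bullet> ?G"
    by (simp add: inner_diff_left)
  moreover have "(?y - W (Suc k)) \<bullet> ?G = \<phi> xs (Suc k) - \<phi> xs k - ?D \<bullet> (B (W (Suc k)) - B (W k))"
    unfolding Y_minus_W \<phi>_def by (simp add: inner_diff algebra_simps)
  moreover have "?D \<bullet> (B (W (Suc k)) - B (W k)) \<le> S (Suc k) * (tau * (2 * S (Suc k) + S k))"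
    using norm_cauchy_schwarz[of ?D "B (W (Suc k)) - B (W k)"]
      mult_left_mono[OF W_lip[of k], of "S (Suc k)"]
    by (simp add: S_def)
  ultimately show ?thesis
    using 1 B_monotone[of "W (Suc k)" xs] by (simp add: algebra_simps)
qed

lemma V_decrease:
  assumes "fixed_pair zs xs"
  shows "V zs xs (Suc k) + 1 / 10 * (e (Suc k))\<^sup>2 + 1 / 20 * (S (Suc k))\<^sup>2 \<le> V zs xs k"
proof -
  define s t a where "s = S (Suc k)" and "t = S k" and "a = e k"
  have nn: "0 \<le> s" "0 \<le> t" "0 \<le> a" by (simp_all add: s_def t_def a_def S_def e_def)
  have tau_le: "tau * (2 * s + t) \<le> 1 / 22 * (2 * s + t)"
    using tau nn by (intro mult_right_mono) auto
  have "S (Suc (Suc k)) \<le> a + 1 / 22 * (2 * s + t)"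
    using S_bound[of k] tau_le unfolding s_def t_def a_def by linarith
  then have "(S (Suc (Suc k)))\<^sup>2 \<le> (a + 1 / 22 * (2 * s + t))\<^sup>2"
    by (rule power_mono) (simp add: S_def)
  \<comment> \<open>Dropping the squared difference gives
    \<open>(a + b)\<^sup>2 \<le> 2 * a\<^sup>2 + 2 * b\<^sup>2\<close>, the source of the factor 2
    in the choice of weights.\<close>
  moreover have "(a + 1 / 22 * (2 * s + t))\<^sup>2 + (a - 1 / 22 * (2 * s + t))\<^sup>2
      = 2 * a\<^sup>2 + 1 / 242 * (4 * s\<^sup>2 + 4 * (s * t) + t\<^sup>2)"
    by (simp add: power2_eq_square algebra_simps)
  moreover have "0 \<le> (a - 1 / 22 * (2 * s + t))\<^sup>2" by simp
  moreover have "0 \<le> (s - t)\<^sup>2" by simp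
  then have "2 * (s * t) \<le> s\<^sup>2 + t\<^sup>2" by (simp add: power2_diff)
  moreover have "2 * s * (tau * (2 * s + t)) \<le> 2 * s * (1 / 22 * (2 * s + t))"
    using tau_le nn by (intro mult_left_mono) auto
  then have "2 * tau * s * (2 * s + t) \<le> 1 / 11 * (2 * s\<^sup>2 + s * t)"
    by (simp add: power2_eq_square algebra_simps)
  moreover have "0 \<le> a\<^sup>2" "0 \<le> s\<^sup>2" "0 \<le> t\<^sup>2" by simp_all
  moreover note energy[OF assms, of k]
  \<comment> \<open>The coefficients become \<open>4/5 - 9/10\<close> for \<open>a\<^sup>2\<close>,
    \<open>- 3/10 + 5/22 + 6/605\<close> for \<open>s\<^sup>2\<close> and
    \<open>- 1/10 + 1/22 + 3/605\<close> for \<open>t\<^sup>2\<close>: all negative, the second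
    below \<open>- 1/20\<close>.\<close>
  ultimately show ?thesis
    unfolding V_def s_def[symmetric] t_def[symmetric] a_def[symmetric] by argo
qed

text \<open>The path from \<open>W k\<close> to \<open>xs\<close> runs through
  \<open>Y (Suc (Suc k))\<close>, and \<open>x k\<close> is controlled by \<open>z k\<close>. The
  distance is then moved to \<open>z (Suc k)\<close>, the one occurring in \<open>V\<close>.\<close>

lemma \<phi>_bound:
  assumes "fixed_pair zs xs"
  shows "\<bar>2 * \<phi> xs k\<bar> \<le> 1 / 11 * S (Suc k) * (norm (z (Suc k) - zs) + 2 * e k + S (Suc k) + S k)"
proof -
  let ?y = "Y (Suc (Suc k))"
  have "norm (z k - zs) \<le> norm (z (Suc k) - zs) + e k"
    using norm_triangle_ineq4[of "z (Suc k) - zs" "z (Suc k) - z k"] by (simp add: e_def)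
  moreover have "?y - xs = (x k - xs) + (z (Suc k) - z k)"
    using z[of k] by simp
  then have "norm (?y - xs) \<le> norm (x k - xs) + e k"
    by (metis e_def norm_triangle_ineq)
  moreover note x_bound[OF assms, of k]
  moreover have "norm (?y - W k) \<le> S (Suc k) + S k"
    unfolding Y_minus_W S_def by (rule norm_triangle_ineq4)
  moreover have "norm (W k - xs) \<le> norm (?y - xs) + norm (?y - W k)"
    using norm_triangle_ineq4[of "?y - xs" "?y - W k"] by simp
  ultimately have W: "norm (W k - xs) \<le> norm (z (Suc k) - zs) + 2 * e k + S (Suc k) + S k"
    by linarith
  have "norm (B (W k) - B xs) \<le> tau * norm (W k - xs)" by (rule lip)
  also have "\<dots> \<le> 1 / 22 * norm (W k - xs)" using tau by (intro mult_right_mono) auto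
  also have "\<dots> \<le> 1 / 22 * (norm (z (Suc k) - zs) + 2 * e k + S (Suc k) + S k)"
    using W by simp
  finally have "S (Suc k) * norm (B (W k) - B xs)
      \<le> S (Suc k) * (1 / 22 * (norm (z (Suc k) - zs) + 2 * e k + S (Suc k) + S k))"
    by (rule mult_left_mono) (simp add: S_def)
  moreover have "\<bar>\<phi> xs k\<bar> \<le> S (Suc k) * norm (B (W k) - B xs)"
    unfolding \<phi>_def S_def by (rule Cauchy_Schwarz_ineq2)
  ultimately have "\<bar>\<phi> xs k\<bar> \<le> S (Suc k) * (1 / 22 * (norm (z (Suc k) - zs) + 2 * e k + S (Suc k) + S k))"
    by linarith
  then show ?thesis by (simp add: abs_mult)
qed

text \<open>Splitting the products in \<open>\<phi>_bound\<close> into squares costs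
  \<open>1 / 22\<close> of the squared distance; the step terms are covered by the weights in
  \<open>V\<close>, for instance \<open>3/11\<close> against \<open>2/5\<close> for
  \<open>s\<^sup>2\<close>.\<close>

lemma V_lower:
  assumes "fixed_pair zs xs"
  shows "21 / 22 * (norm (z (Suc k) - zs))\<^sup>2 \<le> V zs xs k"
proof -
  define s t a u where "s = S (Suc k)" and "t = S k" and "a = e k" and "u = norm (z (Suc k) - zs)"
  have "\<bar>2 * \<phi> xs k\<bar> \<le> 1 / 11 * (s * u + 2 * (s * a) + s\<^sup>2 + s * t)"
    using \<phi>_bound[OF assms, of k] unfolding s_def t_def a_def u_def
    by (simp add: power2_eq_square algebra_simps)
  moreover have amgm: "2 * (b * c) \<le> b\<^sup>2 + c\<^sup>2" for b c :: real
    using zero_le_power2[of "b - c"] by (simp add: power2_diff)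
  note amgm[of s u] amgm[of s a] amgm[of s t]
  moreover have "0 \<le> a\<^sup>2" "0 \<le> s\<^sup>2" "0 \<le> t\<^sup>2" by simp_all
  ultimately show ?thesis
    unfolding V_def s_def[symmetric] t_def[symmetric] a_def[symmetric] u_def[symmetric] by argo
qed

lemma V_convergent:
  assumes "fixed_pair zs xs"
  shows "convergent (V zs xs)"
proof -
  have "V zs xs (Suc k) \<le> V zs xs k" for k
    using V_decrease[OF assms, of k] zero_le_power2[of "e (Suc k)"] zero_le_power2[of "S (Suc k)"]
    by linarith
  then have "decseq (V zs xs)" by (rule decseq_SucI)
  moreover have "0 \<le> V zs xs k" for k
    using V_lower[OF assms, of k] zero_le_power2[of "norm (z (Suc k) - zs)"] by linarith
  ultimately show ?thesis
    using decseq_convergent[of "V zs xs" 0] convergent_def by blast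
qed

lemma steps_null:
  assumes "fixed_pair zs xs"
  shows "e \<longlonglongrightarrow> 0" "S \<longlonglongrightarrow> 0"
proof -
  obtain l where l: "V zs xs \<longlonglongrightarrow> l" using V_convergent[OF assms] by (auto simp: convergent_def)
  have "(\<lambda>k. V zs xs k - V zs xs (Suc k)) \<longlonglongrightarrow> l - l"
    by (intro tendsto_diff LIMSEQ_Suc l)
  \<comment> \<open>The factor 20 covers both margins of \<open>V_decrease\<close>,
    \<open>1 / 10\<close> and \<open>1 / 20\<close>.\<close>
  then have D: "(\<lambda>k. 20 * (V zs xs k - V zs xs (Suc k))) \<longlonglongrightarrow> 0"
    by (intro tendsto_mult_right_zero) simp
  have le: "(e (Suc k))\<^sup>2 \<le> 20 * (V zs xs k - V zs xs (Suc k))"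
    "(S (Suc k))\<^sup>2 \<le> 20 * (V zs xs k - V zs xs (Suc k))" for k
    using V_decrease[OF assms, of k] zero_le_power2[of "e (Suc k)"] zero_le_power2[of "S (Suc k)"]
    by argo+
  have "(\<lambda>k. (e (Suc k))\<^sup>2) \<longlonglongrightarrow> 0" "(\<lambda>k. (S (Suc k))\<^sup>2) \<longlonglongrightarrow> 0"
    by (rule Lim_null_comparison[OF always_eventually[OF allI] D]; use le in simp)+
  from this[THEN tendsto_real_sqrt] have "(\<lambda>k. e (Suc k)) \<longlonglongrightarrow> 0" "(\<lambda>k. S (Suc k)) \<longlonglongrightarrow> 0"
    by (simp_all add: tendsto_rabs_zero_iff)
  then show "e \<longlonglongrightarrow> 0" "S \<longlonglongrightarrow> 0" by (simp_all add: filterlim_sequentially_Suc)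
qed

lemma bounded_z:
  assumes "fixed_pair zs xs"
  shows "bounded (range z)"
proof -
  have "Bseq (V zs xs)" using V_convergent[OF assms] by (rule convergent_imp_Bseq)
  then obtain K where K: "\<And>k. \<bar>V zs xs k\<bar> \<le> K" by (auto simp: Bseq_def)
  have "norm (z (Suc k)) \<le> norm zs + (1 + 22 / 21 * K)" for k
  proof -
    have "(norm (z (Suc k) - zs))\<^sup>2 \<le> 22 / 21 * K"
      using V_lower[OF assms, of k] K[of k] by linarith
    \<comment> \<open>This supplies \<open>r \<le> 1 + r\<^sup>2\<close> for the distance
      \<open>r\<close>, which avoids a square root.\<close>
    moreover have "0 \<le> (norm (z (Suc k) - zs) - 1)\<^sup>2" by simp
    moreover have "0 \<le> (norm (z (Suc k) - zs))\<^sup>2" by simp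
    ultimately have "norm (z (Suc k) - zs) \<le> 1 + 22 / 21 * K"
      unfolding power2_diff power_one mult_1_right by linarith
    then show ?thesis
      using norm_triangle_ineq[of zs "z (Suc k) - zs"] by simp
  qed
  then have "norm (z k) \<le> max (norm (z 0)) (norm zs + (1 + 22 / 21 * K))" for k
    by (cases k) (auto simp: le_max_iff_disj)
  then show ?thesis unfolding bounded_iff by blast
qed

lemma bounded_x:
  assumes "fixed_pair zs xs"
  shows "bounded (range x)"
proof -
  obtain K where K: "\<And>k. norm (z k) \<le> K"
    using bounded_z[OF assms] by (auto simp: bounded_iff)
  have "norm (x k) \<le> norm xs + K + norm zs" for k
    using x_bound[OF assms, of k] K[of k] norm_triangle_ineq4[of "z k" zs]
      norm_triangle_ineq[of xs "x k - xs"] by simp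
  then show ?thesis unfolding bounded_iff by blast
qed

text \<open>\<open>V\<close> converges and its other terms vanish in the limit,
  \<open>\<phi>\<close> because \<open>z\<close> is bounded and the increments tend to zero.\<close>

lemma distance_convergent:
  assumes "fixed_pair zs xs"
  shows "convergent (\<lambda>k. (norm (z k - zs))\<^sup>2)"
proof -
  note S = steps_null(2)[OF assms] and e = steps_null(1)[OF assms]
  have S1: "(\<lambda>k. S (Suc k)) \<longlonglongrightarrow> 0" using S by (rule LIMSEQ_Suc)
  obtain K where K: "\<And>k. norm (z k) \<le> K"
    using bounded_z[OF assms] by (auto simp: bounded_iff)
  have bd: "norm (2 * \<phi> xs k) \<le> 1 / 11 * S (Suc k) * ((K + norm zs) + 2 * e k + S (Suc k) + S k)" for k
  proof -
    have "norm (z (Suc k) - zs) \<le> K + norm zs"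
      using K[of "Suc k"] norm_triangle_ineq4[of "z (Suc k)" zs] by linarith
    then have "1 / 11 * S (Suc k) * (norm (z (Suc k) - zs) + 2 * e k + S (Suc k) + S k)
        \<le> 1 / 11 * S (Suc k) * ((K + norm zs) + 2 * e k + S (Suc k) + S k)"
      by (intro mult_left_mono) (auto simp: S_def)
    with \<phi>_bound[OF assms, of k] show ?thesis unfolding real_norm_def by linarith
  qed
  have "(\<lambda>k. 1 / 11 * S (Suc k) * ((K + norm zs) + 2 * e k + S (Suc k) + S k))
      \<longlonglongrightarrow> 1 / 11 * 0 * ((K + norm zs) + 2 * 0 + 0 + 0)"
    by (intro tendsto_intros S S1 e)
  then have "(\<lambda>k. 1 / 11 * S (Suc k) * ((K + norm zs) + 2 * e k + S (Suc k) + S k)) \<longlonglongrightarrow> 0"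
    by simp
  then have \<phi>: "(\<lambda>k. 2 * \<phi> xs k) \<longlonglongrightarrow> 0"
    by (rule Lim_null_comparison[OF always_eventually[OF allI[OF bd]]])
  obtain l where l: "V zs xs \<longlonglongrightarrow> l" using V_convergent[OF assms] by (auto simp: convergent_def)
  have "(\<lambda>k. V zs xs k - 2 * \<phi> xs k - 2 / 5 * (S (Suc k))\<^sup>2 - 1 / 10 * (S k)\<^sup>2 - 9 / 10 * (e k)\<^sup>2)
      \<longlonglongrightarrow> l - 0 - 2 / 5 * 0\<^sup>2 - 1 / 10 * 0\<^sup>2 - 9 / 10 * 0\<^sup>2"
    by (intro tendsto_diff tendsto_mult_left tendsto_power l \<phi> S S1 e)
  then have "(\<lambda>k. (norm (z (Suc k) - zs))\<^sup>2) \<longlonglongrightarrow> l" by (simp add: V_def)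
  then show ?thesis by (auto simp: convergent_def filterlim_sequentially_Suc[of "\<lambda>k. (norm (z k - zs))\<^sup>2"])
qed

section \<open>Weak cluster points and convergence of the iteration\<close>

lemma Minty_sum: "\<exists>q. w - B q - q \<in> C q"
proof -
  \<comment> \<open>A fixed point of this map solves the inclusion; it is a contraction because the
    resolvent of \<open>C\<close> is nonexpansive and \<open>tau \<le> 1 / 22\<close>.\<close>
  define T where "T = (\<lambda>v. resolvent C (w - B v))"
  have T: "w - B v - T v \<in> C (T v)" for v
    unfolding T_def by (rule resolvent_eq_iff[OF C, THEN iffD1, OF refl])
  have "dist (T u) (T v) \<le> 1 / 22 * dist u v" for u v
  proof -
    let ?P = "T u - T v" and ?U = "B v - B u"
    have "0 \<le> ?P \<bullet> (?U - ?P)"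
      using maximally_monotoneD[OF C T T, of u v] by (simp add: algebra_simps)
    then have "norm ?P \<le> norm ?U"
      by (rule monotone_pair_bound(1)[where Q = 0]) simp
    also have "\<dots> \<le> tau * norm (v - u)" by (rule lip)
    also have "\<dots> \<le> 1 / 22 * norm (v - u)" using tau by (intro mult_right_mono) auto
    finally show ?thesis by (simp add: dist_norm norm_minus_commute)
  qed
  then obtain q where "T q = q"
    using banach_fix_type[of "1 / 22" T] by auto
  with T[of q] show ?thesis by auto
qed

text \<open>
  Both inclusions along the sequence are tested against points \<open>p\<close> and \<open>q\<close> of the graphs of \<open>A\<close> and
  \<open>B + C\<close> supplied by Minty's theorem. On adding them, the products of two weakly convergent
  factors cancel, and the limit is \<open>0 \<le> - (norm (xb - p))\<^sup>2 - (norm (xb - q))\<^sup>2\<close>.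
\<close>

lemma weak_cluster_fixed_pair:
  assumes fp: "fixed_pair zs xs" and r: "strict_mono (r :: nat \<Rightarrow> nat)"
    and zr: "weakly_converges (z \<circ> r) zb" and xr: "weakly_converges (x \<circ> r) xb"
  shows "fixed_pair zb xb"
proof -
  \<comment> \<open>The arguments \<open>zb\<close> and \<open>2 *\<^sub>R xb - zb\<close> are
    chosen so that \<open>p = xb\<close> and \<open>q = xb\<close> together give the
    conclusion.\<close>
  obtain p where p: "zb - p \<in> A p" using Minty[OF A] by blast
  obtain q where q: "2 *\<^sub>R xb - zb - B q - q \<in> C q" using Minty_sum by blast
  define \<beta> where "\<beta> = 2 *\<^sub>R xb - zb - q"
  define a where "a = (\<lambda>k. z k - x k)"
  define d where "d = (\<lambda>k. z (Suc k) - z k)"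
  define b where "b = (\<lambda>k. B (Y (Suc (Suc k))) - B (W k))"
  \<comment> \<open>Each product in \<open>R\<close> pairs a bounded factor with one tending to zero
    in norm; the rest of \<open>ineq\<close> is affine in \<open>z k\<close> and \<open>x k\<close>,
    so weak limits suffice there.\<close>
  define R where "R = (\<lambda>k. (a k + \<beta>) \<bullet> (- d k) + (x k + d k - q) \<bullet> (b k - d k))"
  have Yk: "Y (Suc (Suc k)) = x k + d k" for k using z[of k] by (simp add: d_def)
  have ineq: "0 \<le> (q - p) \<bullet> a k - (x k - p) \<bullet> (zb - p) - (x k - q) \<bullet> \<beta> + R k" for k
  proof -
    have 1: "0 \<le> (x k - p) \<bullet> (a k - (zb - p))"
      unfolding a_def by (rule maximally_monotoneD[OF A x p])
    have 2: "0 \<le> (Y (Suc (Suc k)) - q) \<bullet> (B (Y (Suc (Suc k))) - B q)" by (rule B_monotone)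
    have 3: "0 \<le> (Y (Suc (Suc k)) - q) \<bullet> (2 *\<^sub>R x k - z k - B (W k) - Y (Suc (Suc k)) - (2 *\<^sub>R xb - zb - B q - q))"
      unfolding W_def by (rule maximally_monotoneD[OF C Y q])
    have "(B (Y (Suc (Suc k))) - B q) + (2 *\<^sub>R x k - z k - B (W k) - Y (Suc (Suc k)) - (2 *\<^sub>R xb - zb - B q - q))
        = b k - d k - a k - \<beta>"
      unfolding b_def \<beta>_def a_def Yk by (simp add: algebra_simps scaleR_2)
    with add_nonneg_nonneg[OF 2 3] have "0 \<le> (x k + d k - q) \<bullet> (b k - d k - a k - \<beta>)"
      by (simp only: Yk inner_add_right[symmetric])
    with 1 show ?thesis
      unfolding R_def by (simp add: inner_diff inner_add inner_commute algebra_simps)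
  qed
  have d0: "d \<longlonglongrightarrow> 0"
    using steps_null(1)[OF fp] by (simp add: d_def e_def[abs_def] tendsto_norm_zero_iff)
  have b_le: "norm (b k) \<le> 1 / 22 * (S (Suc k) + S k)" for k
  proof -
    have "norm (b k) \<le> tau * norm (Y (Suc (Suc k)) - W k)" unfolding b_def by (rule lip)
    also have "\<dots> \<le> 1 / 22 * norm (Y (Suc (Suc k)) - W k)" using tau by (intro mult_right_mono) auto
    also have "\<dots> \<le> 1 / 22 * (S (Suc k) + S k)"
      unfolding Y_minus_W S_def by (intro mult_left_mono norm_triangle_ineq4) simp
    finally show ?thesis .
  qed
  have "(\<lambda>k. S (Suc k) + S k) \<longlonglongrightarrow> 0 + 0"
    by (intro tendsto_add LIMSEQ_Suc steps_null(2)[OF fp])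
  then have "(\<lambda>k. 1 / 22 * (S (Suc k) + S k)) \<longlonglongrightarrow> 0"
    by (intro tendsto_mult_right_zero) simp
  then have b0: "b \<longlonglongrightarrow> 0"
    by (rule Lim_null_comparison[OF always_eventually[OF allI[OF b_le]]])
  have bz: "bounded (range z)" "bounded (range x)" by (rule bounded_z[OF fp], rule bounded_x[OF fp])
  have bdd: "bounded (range d)" using d0 by (simp add: convergent_imp_bounded)
  have const: "bounded (range (\<lambda>_::nat. v))" for v :: 'a
    by (simp add: image_constant_conv)
  have ba: "bounded (range (\<lambda>k. a k + \<beta>))"
    unfolding a_def by (intro bounded_plus_comp bounded_minus_comp bz const)
  have bx: "bounded (range (\<lambda>k. x k + d k - q))"
    by (intro bounded_plus_comp bounded_minus_comp bz bdd const)
  have "(\<lambda>k. R k) \<longlonglongrightarrow> 0 + 0"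
    unfolding R_def
  proof (intro tendsto_add inner_bounded_null ba bx)
    show "(\<lambda>k. - d k) \<longlonglongrightarrow> 0" using tendsto_minus[OF d0] by simp
    show "(\<lambda>k. b k - d k) \<longlonglongrightarrow> 0" using tendsto_diff[OF b0 d0] by simp
  qed
  then have R0: "(\<lambda>k. R (r k)) \<longlonglongrightarrow> 0"
    using LIMSEQ_subseq_LIMSEQ[OF _ r, of R 0] by (simp add: o_def)
  have lim: "(\<lambda>k. x (r k) \<bullet> v) \<longlonglongrightarrow> xb \<bullet> v" "(\<lambda>k. z (r k) \<bullet> v) \<longlonglongrightarrow> zb \<bullet> v" for v
    using xr zr by (simp_all add: weakly_converges_def)
  have "(\<lambda>k. (z (r k) \<bullet> (q - p) - x (r k) \<bullet> (q - p)) - (x (r k) \<bullet> (zb - p) - p \<bullet> (zb - p))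
        - (x (r k) \<bullet> \<beta> - q \<bullet> \<beta>) + R (r k))
      \<longlonglongrightarrow> (zb \<bullet> (q - p) - xb \<bullet> (q - p)) - (xb \<bullet> (zb - p) - p \<bullet> (zb - p)) - (xb \<bullet> \<beta> - q \<bullet> \<beta>) + 0"
    by (intro tendsto_diff tendsto_add lim R0 tendsto_const)
  then have "0 \<le> (zb \<bullet> (q - p) - xb \<bullet> (q - p)) - (xb \<bullet> (zb - p) - p \<bullet> (zb - p)) - (xb \<bullet> \<beta> - q \<bullet> \<beta>) + 0"
  proof (rule LIMSEQ_le_const)
    have "0 \<le> (z (r k) \<bullet> (q - p) - x (r k) \<bullet> (q - p)) - (x (r k) \<bullet> (zb - p) - p \<bullet> (zb - p))
        - (x (r k) \<bullet> \<beta> - q \<bullet> \<beta>) + R (r k)" for k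
      using ineq[of "r k"] by (simp add: a_def inner_diff inner_commute algebra_simps)
    then show "\<exists>N. \<forall>n\<ge>N. 0 \<le> (z (r n) \<bullet> (q - p) - x (r n) \<bullet> (q - p)) - (x (r n) \<bullet> (zb - p) - p \<bullet> (zb - p))
        - (x (r n) \<bullet> \<beta> - q \<bullet> \<beta>) + R (r n)" by blast
  qed
  also have "\<dots> = - ((xb - p) \<bullet> (xb - p)) - (xb - q) \<bullet> (xb - q)"
    unfolding \<beta>_def by (simp add: inner_diff inner_commute algebra_simps)
  finally have "(xb - p) \<bullet> (xb - p) = 0" "(xb - q) \<bullet> (xb - q) = 0"
    using inner_ge_zero[of "xb - p"] inner_ge_zero[of "xb - q"] by linarith+
  then have eq: "p = xb" "q = xb" by simp_all
  have "2 *\<^sub>R xb - zb - B xb - xb = xb - zb - B xb" by (simp add: algebra_simps scaleR_2)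
  then show ?thesis using p q unfolding fixed_pair_def eq by metis
qed

text \<open>\<open>Opial\<close> is applied to the first components of fixed pairs. Since
  \<open>A\<close> determines \<open>xb\<close> from \<open>zb\<close>, all weak cluster points of
  \<open>x\<close> coincide, and \<open>y\<close> differs from \<open>x\<close> by an increment of
  \<open>z\<close>.\<close>

theorem weak_convergence:
  assumes fp: "fixed_pair zs xs"
  obtains zb xb where "weakly_converges z zb" "weakly_converges x xb"
    "weakly_converges (\<lambda>k. Y (Suc (Suc k))) xb" "fixed_pair zb xb"
proof -
  obtain zb where zb: "zb \<in> {l. \<exists>xl. fixed_pair l xl}" "weakly_converges z zb"
  proof (rule Opial[OF bounded_z[OF fp]])
    show "convergent (\<lambda>n. (norm (z n - p))\<^sup>2)" if "p \<in> {l. \<exists>xl. fixed_pair l xl}" for p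
      using that distance_convergent by blast
    show "l \<in> {l. \<exists>xl. fixed_pair l xl}"
      if r: "strict_mono (r :: nat \<Rightarrow> nat)" "weakly_converges (z \<circ> r) l" for r l
    proof -
      have "bounded (range (x \<circ> r))"
        by (rule bounded_subset[OF bounded_x[OF fp]]) auto
      then obtain s m where s: "strict_mono s" "weakly_converges (x \<circ> r \<circ> s) m"
        by (rule weakly_convergent_subsequence)
      have "weakly_converges (z \<circ> (r \<circ> s)) l"
        using weakly_converges_subseq[OF r(2) s(1)] by (simp add: o_assoc)
      then have "fixed_pair l m"
        using weak_cluster_fixed_pair[OF fp strict_mono_o[OF r(1) s(1)]] s(2) by (simp add: o_assoc)
      then show ?thesis by blast
    qed
  qed
  then obtain xb where xb: "fixed_pair zb xb" by blast
  have x: "weakly_converges x xb"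
  proof (rule weakly_converges_of_subsequences[OF bounded_x[OF fp]])
    fix r l assume r: "strict_mono (r :: nat \<Rightarrow> nat)" "weakly_converges (x \<circ> r) l"
    have "weakly_converges (z \<circ> r) zb"
      by (rule weakly_converges_subseq[OF zb(2) r(1)])
    then have "fixed_pair zb l" using weak_cluster_fixed_pair[OF fp r(1)] r(2) by blast
    then show "l = xb"
      using xb resolvent_inclusion_unique[OF A] by (auto simp: fixed_pair_def)
  qed
  have "(\<lambda>k. z (Suc k) - z k) \<longlonglongrightarrow> 0"
    using steps_null(1)[OF fp] by (simp add: e_def[abs_def] tendsto_norm_zero_iff)
  have "(\<lambda>k. Y (Suc (Suc k)) \<bullet> u) \<longlonglongrightarrow> xb \<bullet> u" for u
  proof -
    have "(\<lambda>k. x k \<bullet> u + z (Suc k) \<bullet> u - z k \<bullet> u) \<longlonglongrightarrow> xb \<bullet> u + zb \<bullet> u - zb \<bullet> u"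
      using x zb(2) unfolding weakly_converges_def
      by (intro tendsto_diff tendsto_add LIMSEQ_Suc[of "\<lambda>k. z k \<bullet> u"]) blast+
    then show ?thesis by (simp add: z inner_add_left inner_diff_left)
  qed
  then have "weakly_converges (\<lambda>k. Y (Suc (Suc k))) xb" by (simp add: weakly_converges_def)
  with zb(2) x xb show thesis using that by blast
qed

end

section \<open>Reduction to unit step size\<close>

theorem theorem7:
  fixes A C :: "'a::{real_inner, complete_space} \<Rightarrow> 'a set"
    and B :: "'a \<Rightarrow> 'a"
    and L lam :: real
    and x z :: "nat \<Rightarrow> 'a"
    and y :: "int \<Rightarrow> 'a"
  assumes "maximally_monotone A"
    and "maximally_monotone C"
    and "monotone_operator (\<lambda>p. {B p})"
    and "L > 0"
    and "L-lipschitz_on UNIV B"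
    and "operator_inverse (\<lambda>p. A p + {B p} + C p) 0 \<noteq> {}"
    and "lam \<in> {0<..<1 / (22 * L)}"
    and "\<And>k. x k = resolvent (scale_operator lam A) (z k)"
    and "\<And>k. y (int k) = resolvent (scale_operator lam C)
               (2 *\<^sub>R x k - z k - lam *\<^sub>R B (2 *\<^sub>R y (int k - 1) - y (int k - 2)))"
    and "\<And>k. z (Suc k) = z k + y (int k) - x k"
  shows "\<exists>zbar xbar.
           weakly_converges z zbar \<and>
           weakly_converges x xbar \<and> weakly_converges (\<lambda>k. y (int k)) xbar \<and>
           xbar = resolvent (scale_operator lam A) zbar \<and>
           xbar \<in> operator_inverse (\<lambda>p. A p + {B p} + C p) 0"
proof -
  note lam = \<open>lam \<in> {0<..<1 / (22 * L)}\<close>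
  have "lam > 0" using lam by simp
  define A' where "A' = scale_operator lam A"
  define C' where "C' = scale_operator lam C"
  define Y where "Y = (\<lambda>n. y (int n - 2))"
  have Y_y: "Y (Suc (Suc k)) = y (int k)" "Y (Suc k) = y (int k - 1)" "Y k = y (int k - 2)" for k
    by (simp_all add: Y_def)
  have A': "maximally_monotone A'" and C': "maximally_monotone C'"
    unfolding A'_def C'_def using assms(1,2) \<open>lam > 0\<close> by (auto intro: maximally_monotone_scale)
  interpret brfb A' C' "\<lambda>p. lam *\<^sub>R B p" "lam * L" x z Y
  proof
    show "monotone_operator (\<lambda>p. {lam *\<^sub>R B p})"
      unfolding monotone_operator_def
    proof (intro allI ballI)
      fix p q u v assume "u \<in> {lam *\<^sub>R B p}" "v \<in> {lam *\<^sub>R B q}"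
      then have "(p - q) \<bullet> (u - v) = lam * ((p - q) \<bullet> (B p - B q))"
        by (simp add: inner_diff_right right_diff_distrib)
      moreover have "0 \<le> (p - q) \<bullet> (B p - B q)"
        using assms(3) by (simp add: monotone_operator_def)
      ultimately show "0 \<le> (p - q) \<bullet> (u - v)" using \<open>lam > 0\<close> by simp
    qed
    show "norm (lam *\<^sub>R B p - lam *\<^sub>R B q) \<le> lam * L * norm (p - q)" for p q
    proof -
      have "norm (B p - B q) \<le> L * norm (p - q)"
        using lipschitz_onD[OF assms(5), of p q] by (simp add: dist_norm)
      moreover have "norm (lam *\<^sub>R B p - lam *\<^sub>R B q) = lam * norm (B p - B q)"
        using \<open>lam > 0\<close> norm_scaleR[of lam "B p - B q"] by (simp only: scaleR_diff_right abs_of_pos)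
      ultimately show ?thesis using \<open>lam > 0\<close> by simp
    qed
    show "0 \<le> lam * L" "lam * L \<le> 1 / 22"
      using lam \<open>L > 0\<close> by (auto simp: field_simps)
    show "z k - x k \<in> A' (x k)" for k
      unfolding assms(8) A'_def[symmetric] by (rule resolvent_eq_iff[OF A', THEN iffD1, OF refl])
    show "2 *\<^sub>R x k - z k - lam *\<^sub>R B (2 *\<^sub>R Y (Suc k) - Y k) - Y (Suc (Suc k)) \<in> C' (Y (Suc (Suc k)))" for k
      \<comment> \<open>\<open>Y_y(3)\<close> matches every argument and \<open>Y_y(2)\<close> every
        successor, so the most specific rule goes first.\<close>
      unfolding Y_y(1) unfolding Y_y(2) unfolding Y_y(3)
      by (rule resolvent_eq_iff[OF C', THEN iffD1, OF assms(9)[folded C'_def, symmetric]])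
    show "z (Suc k) = z k + (Y (Suc (Suc k)) - x k)" for k
      using assms(10)[of k] by (simp add: Y_y(1))
  qed (rule A', rule C')
  obtain xs a c where zero: "a \<in> A xs" "c \<in> C xs" "a + B xs + c = 0"
    using assms(6) by (force simp: operator_inverse_def set_plus_def)
  \<comment> \<open>By the choice of the first component, its difference from \<open>xs\<close> is
    \<open>lam *\<^sub>R a\<close>; the inclusion for \<open>C'\<close> is the zero equation times
    \<open>lam\<close>.\<close>
  have "fixed_pair (xs + lam *\<^sub>R a) xs"
  proof -
    have "c = - a - B xs" using zero(3) by (simp add: algebra_simps eq_neg_iff_add_eq_0)
    then have "- (lam *\<^sub>R a) - lam *\<^sub>R B xs = lam *\<^sub>R c"
      by (simp add: scaleR_diff_right)
    then show ?thesis
      using zero(1,2) unfolding fixed_pair_def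
      by (auto simp: A'_def C'_def scale_operator_def)
  qed
  then obtain zb xb where lims: "weakly_converges z zb" "weakly_converges x xb"
    "weakly_converges (\<lambda>k. Y (Suc (Suc k))) xb" and fp: "fixed_pair zb xb"
    by (rule weak_convergence)
  obtain a' c' where a': "a' \<in> A xb" "zb - xb = lam *\<^sub>R a'"
    and c': "c' \<in> C xb" "xb - zb - lam *\<^sub>R B xb = lam *\<^sub>R c'"
    using fp[unfolded fixed_pair_def] by (auto simp: A'_def C'_def scale_operator_def)
  \<comment> \<open>The three scaled terms \<open>zb - xb\<close>, \<open>lam *\<^sub>R B xb\<close>
    and \<open>xb - zb - lam *\<^sub>R B xb\<close> cancel.\<close>
  have "lam *\<^sub>R (a' + B xb + c') = 0"
    by (simp add: scaleR_add_right flip: a'(2) c'(2))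
  then have "a' + B xb + c' = 0" using \<open>lam > 0\<close> by simp
  moreover have "a' + B xb + c' \<in> A xb + {B xb} + C xb"
    using a'(1) c'(1) by (intro set_plus_intro) simp_all
  ultimately have "xb \<in> operator_inverse (\<lambda>p. A p + {B p} + C p) 0"
    by (simp add: operator_inverse_def)
  moreover have "xb = resolvent (scale_operator lam A) zb"
    using fp[unfolded fixed_pair_def] resolvent_eq_iff[OF A', of zb xb] by (simp add: A'_def)
  ultimately show ?thesis using lims unfolding Y_y(1) by blast
qed

end
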